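(* Let $A\in M_n(\mathbb{C})$ and $c_n:=n(n+1)(n+2)(n+3)$. Then \begin{align*} c_n\int_{\mathbb{S}^n}\big|\langle Au,u\rangle\big|^4\,d\sigma(u)=\ &4\,\mathrm{tr}\big(A^2A^{\star2}\big)+2\,\mathrm{tr}\big[(A^\star A)^2\big]+2\big[\mathrm{tr}(A^\star A)\big]^2+8\,\Re\big[\mathrm{tr}(A)\,\mathrm{tr}(AA^{\star2})\big]\\ &+2\,\Re\Big[\mathrm{tr}(A^2)\big[\mathrm{tr}A^\star\big]^2\Big]+\big|\mathrm{tr}(A^2)\big|^2+4\,\mathrm{tr}(A^\star A)\,\big|\mathrm{tr}(A)\big|^2+\big|\mathrm{tr}(A)\big|^4. \end{align*} Equivalently, $\Phi'_4(A):=\Big(\int_{\mathbb{S}^n}|\langle A\xi,\xi\rangle|^4\,d\sigma(\xi)\Big)^{1/4}$ satisfies \begin{align*} \Phi'_4(A)=\Bigg(\frac{1}{c_n}\bigg\{&4\lVert A^2\rVert_F^2+2\lVert A\rVert_{(4)}^4+2\lVert A\rVert_F^4+8\,\Re\big[\mathrm{tr}(A)\,\mathrm{tr}(AA^{\star2})\big]+2\,\Re\Big[\mathrm{tr}(A^2)\big[\mathrm{tr}A^\star\big]^2\Big]\\ &+4\lVert A\rVert_F^2\,|\mathrm{tr}(A)|^2+|\mathrm{tr}(A^2)|^2+|\mathrm{tr}(A)|^4\bigg\}\Bigg)^{1/4}. \end{align*}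
   Context: $\mathbb{S}^n$ is the unit sphere of $\mathbb{C}^n$, $\sigma$ the normalized Euclidean surface measure on it, $\langle\cdot,\cdot\rangle$ the standard Hermitian inner product, $A^\star$ the conjugate transpose of $A$, $A^{\star 2}=(A^\star)^2$, and $\Re$ the real part. $\lVert\cdot\rVert_F$ is the Frobenius norm and $\lVert A\rVert_{(4)}=[\mathrm{tr}(|A|^4)]^{1/4}$, with $|A|=\sqrt{A^\star A}$, the Schatten 4-norm. *)

theory Defs
  imports "HOL-Analysis.Analysis"
begin

text \<open>The surface measure of the unit sphere in polar coordinates: the measure of
  a Borel set \<open>E\<close> of unit vectors is the dimension times the Lebesgue measure of the truncated
  cone \<open>{r x | 0 < r < 1, x \<in> E}\<close>, that is, the measure characterised by
  \<open>dx = r ^ (DIM - 1) dr dS\<close>. On the complex space \<open>complex ^ 'n\<close> the dimension is the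
  real one, twice \<open>CARD('n)\<close>.\<close>

definition surface_measure :: "'a::euclidean_space measure" where
  "surface_measure =
     scale_measure (of_nat DIM('a))
       (distr (restrict_space lborel (ball 0 1 - {0})) (restrict_space borel (sphere 0 1))
          (\<lambda>x. x /\<^sub>R norm x))"

definition sphere_sigma :: "'a::euclidean_space measure" where
  "sphere_sigma =
     scale_measure (inverse (emeasure (surface_measure :: 'a measure) (sphere 0 1))) surface_measure"

definition cinner :: "complex ^ 'n \<Rightarrow> complex ^ 'n \<Rightarrow> complex" where
  "cinner u v = (\<Sum>i\<in>UNIV. u $ i * cnj (v $ i))"

definition ctranspose :: "complex ^ 'n ^ 'm \<Rightarrow> complex ^ 'm ^ 'n" where
  "ctranspose A = (\<chi> i j. cnj (A $ j $ i))"

primrec mat_pow :: "complex ^ 'n ^ 'n \<Rightarrow> nat \<Rightarrow> complex ^ 'n ^ 'n" where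
  "mat_pow A 0 = mat 1"
| "mat_pow A (Suc k) = A ** mat_pow A k"

definition pos_semidef :: "complex ^ 'n ^ 'n \<Rightarrow> bool" where
  "pos_semidef B \<longleftrightarrow> ctranspose B = B \<and> (\<forall>x. 0 \<le> Re (cinner (B *v x) x))"

definition mat_sqrt :: "complex ^ 'n ^ 'n \<Rightarrow> complex ^ 'n ^ 'n" where
  "mat_sqrt P = (THE B. pos_semidef B \<and> mat_pow B 2 = P)"

definition mat_abs :: "complex ^ 'n ^ 'n \<Rightarrow> complex ^ 'n ^ 'n" where
  "mat_abs A = mat_sqrt (ctranspose A ** A)"

definition frobenius_norm :: "complex ^ 'n ^ 'n \<Rightarrow> real" where
  "frobenius_norm A = sqrt (\<Sum>i\<in>UNIV. \<Sum>j\<in>UNIV. (cmod (A $ i $ j))\<^sup>2)"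

text \<open>The trace below is that of a positive semidefinite matrix, so taking the real part only
  changes its type.\<close>

definition schatten4_norm :: "complex ^ 'n ^ 'n \<Rightarrow> real" where
  "schatten4_norm A = root 4 (Re (trace (mat_pow (mat_abs A) 4)))"

definition Phi4 :: "complex ^ 'n ^ 'n \<Rightarrow> real" where
  "Phi4 A = root 4 (LINT \<xi>|sphere_sigma. (cmod (cinner (A *v \<xi>) \<xi>)) ^ 4)"

definition c_const :: "nat \<Rightarrow> real" where
  "c_const n = real (n * (n + 1) * (n + 2) * (n + 3))"

end

theory Submission
  imports Defs
begin

text \<open>Replace the sphere by the ball with weight \<open>w\<^sub>j = (1 - |u|\<^sup>2)\<^sup>j\<close>. Integrating by parts in the
  antiholomorphic directions \<open>\<partial> / \<partial>(cnj u\<^sub>q)\<close> gives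
  \<open>(j + 1) \<integral> \<langle>Bu,u\<rangle> P w\<^sub>j = tr B \<integral> P w\<^bsub>j+1\<^esub> + \<integral> \<langle>B dP,u\<rangle> w\<^bsub>j+1\<^esub>\<close>. Applied repeatedly to a product of
  forms \<open>\<langle>A\<^sub>i u,u\<rangle>\<close>, it yields, up to a factor independent of the matrices, the sum over all
  permutations of the products over cycles of the traces \<open>tr (A\<^sub>i A\<^sub>j \<dots>)\<close>. By homogeneity the weighted
  ball integral of \<open>|\<langle>Au,u\<rangle>|\<^sup>4\<close> is its spherical mean times that of \<open>|u|\<^sup>8\<close>, and the case \<open>A = I\<close>
  identifies the remaining constant as \<open>c\<^sub>n\<close>. For the second form one also needs
  that positive semidefinite square roots exist and are unique.\<close>

section \<open>Integration over the sphere\<close>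

lemma nn_integral_lborel_scaleR:
  fixes f :: "'a::euclidean_space \<Rightarrow> ennreal"
  assumes [measurable]: "f \<in> borel_measurable borel" and "0 < c"
  shows "(\<integral>\<^sup>+x. f x \<partial>lborel) = ennreal (c ^ DIM('a)) * (\<integral>\<^sup>+x. f (c *\<^sub>R x) \<partial>lborel)"
proof -
  have "(\<integral>\<^sup>+x. f x \<partial>lborel) =
      (\<integral>\<^sup>+x. f x \<partial>density (distr lborel borel (\<lambda>x. 0 + c *\<^sub>R x)) (\<lambda>_. ennreal (\<bar>c\<bar> ^ DIM('a))))"
    using lborel_affine[of c "0::'a"] \<open>0 < c\<close> by simp
  also have "\<dots> = ennreal (c ^ DIM('a)) * (\<integral>\<^sup>+x. f (c *\<^sub>R x) \<partial>lborel)"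
    using \<open>0 < c\<close> by (simp add: nn_integral_density nn_integral_distr nn_integral_cmult)
  finally show ?thesis .
qed

text \<open>Dilation by \<open>s\<close> leaves \<open>g\<close> unchanged, so only the Jacobian
  remains; \<open>max 0 s\<close> covers the radii \<open>s \<le> 0\<close>, whose ball is
  empty.\<close>

lemma emeasure_radial_lessThan:
  fixes g :: "'a::euclidean_space \<Rightarrow> ennreal"
  assumes g [measurable]: "g \<in> borel_measurable borel"
    and hom: "\<And>c x. 0 < c \<Longrightarrow> g (c *\<^sub>R x) = g x"
  shows "emeasure (distr (density lborel g) borel norm) {..<s} =
    ennreal (max 0 s ^ DIM('a)) * (\<integral>\<^sup>+x. g x * indicator (ball 0 1) x \<partial>lborel)"
proof -
  have "norm -` {..<s} = (ball 0 s :: 'a set)"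
    by auto
  then have "emeasure (distr (density lborel g) borel norm) {..<s} =
      (\<integral>\<^sup>+x. g x * indicator {..<s} (norm x) \<partial>lborel)"
    by (subst emeasure_distr, simp, simp, subst emeasure_density)
      (auto intro!: nn_integral_cong split: split_indicator)
  also have "\<dots> = ennreal (max 0 s ^ DIM('a)) * (\<integral>\<^sup>+x. g x * indicator (ball 0 1) x \<partial>lborel)"
  proof (cases "0 < s")
    case True
    have "indicator {..<s} (norm (s *\<^sub>R x)) = (indicator (ball 0 1) x :: ennreal)" for x :: 'a
      using True by (auto split: split_indicator)
    then show ?thesis
      using True by (subst nn_integral_lborel_scaleR[OF _ True]) (auto simp: hom max_def)
  next
    case False
    then have "indicator {..<s} (norm x) = (0::ennreal)" for x :: 'a
      using norm_ge_zero[of x] by (auto split: split_indicator simp del: norm_ge_zero)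
    then show ?thesis
      using False by (simp add: max_def)
  qed
  finally show ?thesis .
qed

text \<open>Polar coordinates without disintegration: Lebesgue measure and its density
  \<open>g\<close>, pushed forward by \<open>norm\<close>, have distribution functions proportional
  to the same power of the radius. The cross-multiplied form avoids a division in
  \<open>ennreal\<close>.\<close>

lemma nn_integral_angular_radial:
  fixes g :: "'a::euclidean_space \<Rightarrow> ennreal"
  assumes g [measurable]: "g \<in> borel_measurable borel" and \<psi> [measurable]: "\<psi> \<in> borel_measurable borel"
    and hom: "\<And>c x. 0 < c \<Longrightarrow> g (c *\<^sub>R x) = g x"
    and fin: "(\<integral>\<^sup>+x. g x * indicator (ball 0 1) x \<partial>lborel) \<noteq> \<infinity>"
  shows "emeasure lborel (ball 0 1 :: 'a set) * (\<integral>\<^sup>+x. g x * \<psi> (norm x) \<partial>lborel) =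
    (\<integral>\<^sup>+x. g x * indicator (ball 0 1) x \<partial>lborel) * (\<integral>\<^sup>+x. \<psi> (norm (x::'a)) \<partial>lborel)"
proof -
  define V where "V = emeasure lborel (ball 0 1 :: 'a set)"
  define G where "G = (\<integral>\<^sup>+x. g x * indicator (ball 0 1) x \<partial>lborel)"
  define R :: "('a \<Rightarrow> ennreal) \<Rightarrow> real measure" where "R h = distr (density lborel h) borel norm" for h
  have V: "V \<noteq> \<infinity>"
    unfolding V_def using emeasure_lborel_ball_finite by (simp add: less_top[symmetric])
  have R1: "emeasure (R (\<lambda>_. 1)) {..<s} = ennreal (max 0 s ^ DIM('a)) * V" for s
    unfolding R_def V_def by (subst emeasure_radial_lessThan) auto
  have Rg: "emeasure (R g) {..<s} = ennreal (max 0 s ^ DIM('a)) * G" for s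
    unfolding R_def G_def by (subst emeasure_radial_lessThan) (auto simp: hom)
  \<comment> \<open>Open half-lines form an intersection-stable generator of the Borel sets, and
    they have finite measure here.\<close>
  have "scale_measure V (R g) = scale_measure G (R (\<lambda>_. 1))"
  proof (rule measure_eqI_generator_eq[where E="range lessThan" and \<Omega>=UNIV and A="\<lambda>i. {..<real i}"])
    show "Int_stable (range (lessThan :: real \<Rightarrow> real set))"
      by (auto simp: Int_stable_def greaterThan_Int_greaterThan)
    show "emeasure (scale_measure V (R g)) X = emeasure (scale_measure G (R (\<lambda>_. 1))) X"
      if "X \<in> range lessThan" for X
      using that by (auto simp: R1 Rg mult_ac)
    have "sets (borel :: real measure) = sigma_sets UNIV (range lessThan)"
      by (subst borel_eq_lessThan) (simp add: eucl_lessThan lessThan_def)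
    then show "sets (scale_measure V (R g)) = sigma_sets UNIV (range lessThan)"
      "sets (scale_measure G (R (\<lambda>_. 1))) = sigma_sets UNIV (range lessThan)"
      by (simp_all add: R_def)
    show "(\<Union>i. {..<real i}) = UNIV"
      using reals_Archimedean2 by auto
    show "emeasure (scale_measure V (R g)) {..<real i} \<noteq> \<infinity>" for i
      using V fin by (simp add: Rg ennreal_mult_eq_top_iff G_def)
  qed auto
  then have "(\<integral>\<^sup>+r. \<psi> r \<partial>scale_measure V (R g)) = (\<integral>\<^sup>+r. \<psi> r \<partial>scale_measure G (R (\<lambda>_. 1)))"
    by simp
  then have "V * (\<integral>\<^sup>+r. \<psi> r \<partial>R g) = G * (\<integral>\<^sup>+r. \<psi> r \<partial>R (\<lambda>_. 1))"
    by (simp add: nn_integral_scale_measure R_def)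
  then show ?thesis
    unfolding V_def G_def R_def by (simp add: nn_integral_distr nn_integral_density)
qed

text \<open>Normalising cancels the factor \<open>DIM('a)\<close>, so \<open>sphere_sigma\<close>
  averages the radially constant extension of \<open>f\<close> over the unit ball.\<close>

lemma nn_integral_sphere_sigma:
  fixes f :: "'a::euclidean_space \<Rightarrow> ennreal"
  assumes [measurable]: "f \<in> borel_measurable borel"
  shows "(\<integral>\<^sup>+u. f u \<partial>sphere_sigma) =
    (\<integral>\<^sup>+x. f (x /\<^sub>R norm x) * indicator (ball 0 1) x \<partial>lborel) / emeasure lborel (ball 0 1 :: 'a set)"
proof -
  let ?L = "restrict_space lborel (ball 0 1 - {0}) :: 'a measure"
  let ?S = "restrict_space borel (sphere 0 1) :: 'a measure"
  let ?V = "emeasure lborel (ball 0 1 :: 'a set)"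
  have proj [measurable]: "(\<lambda>x. x /\<^sub>R norm x) \<in> measurable ?L ?S"
    by (intro measurable_restrict_space3) (auto simp: divide_simps)
  have [measurable]: "f \<in> borel_measurable ?S"
    by (simp add: measurable_restrict_space1)
  have "unit_ball_vol (real DIM('a)) \<noteq> 0"
    using unit_ball_vol_pos[of "real DIM('a)"] by (metis less_irrefl of_nat_0_le_iff)
  then have V: "?V \<noteq> \<infinity>" "?V \<noteq> 0"
    using emeasure_lborel_ball_finite[of "0::'a" 1]
    by (auto simp: less_top[symmetric] emeasure_ball)
  \<comment> \<open>The origin, removed in \<open>surface_measure\<close>, is a null set, so the
    ball may replace the punctured ball.\<close>
  have zero: "AE x in lborel. x \<noteq> (0::'a)"
    by (rule AE_lborel_singleton)
  have "emeasure (surface_measure :: 'a measure) (sphere 0 1) =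
      of_nat DIM('a) * emeasure ?L ((\<lambda>x. x /\<^sub>R norm x) -` sphere 0 1 \<inter> space ?L)"
    unfolding surface_measure_def emeasure_scale_measure
    by (subst emeasure_distr[OF proj]) (auto simp: sets_restrict_space_iff)
  also have "(\<lambda>x. x /\<^sub>R norm x) -` sphere 0 1 \<inter> space ?L = ball 0 1 - {0}"
    by (auto simp: space_restrict_space divide_simps)
  also have "emeasure ?L (ball 0 1 - {0}) = ?V"
    by (subst emeasure_restrict_space) (auto simp: emeasure_Diff)
  finally have S: "emeasure (surface_measure :: 'a measure) (sphere 0 1) = of_nat DIM('a) * ?V" .
  have "(\<integral>\<^sup>+u. f u \<partial>(surface_measure :: 'a measure)) = of_nat DIM('a) * (\<integral>\<^sup>+x. f (x /\<^sub>R norm x) \<partial>?L)"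
    unfolding surface_measure_def by (simp add: nn_integral_scale_measure nn_integral_distr)
  also have "(\<integral>\<^sup>+x. f (x /\<^sub>R norm x) \<partial>?L) = 
      (\<integral>\<^sup>+x. f (x /\<^sub>R norm x) * indicator (ball 0 1 - {0}) x \<partial>lborel)"
    by (subst nn_integral_restrict_space) auto
  also have "\<dots> = (\<integral>\<^sup>+x. f (x /\<^sub>R norm x) * indicator (ball 0 1) x \<partial>lborel)" (is "_ = ?I")
    using zero by (intro nn_integral_cong_AE) (auto split: split_indicator)
  finally have I: "(\<integral>\<^sup>+u. f u \<partial>(surface_measure :: 'a measure)) = of_nat DIM('a) * ?I" .
  have "f \<in> borel_measurable (surface_measure :: 'a measure)"
    unfolding surface_measure_def by simp
  then have "(\<integral>\<^sup>+u. f u \<partial>sphere_sigma) = inverse (of_nat DIM('a) * ?V) * (of_nat DIM('a) * ?I)"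
    unfolding sphere_sigma_def by (simp add: nn_integral_scale_measure S I)
  also have "\<dots> = ?I / ?V"
  proof -
    obtain v where v: "?V = ennreal v" "0 < v"
      using V by (cases ?V) (auto simp: less_le)
    define d where "d = real DIM('a)"
    have d: "of_nat DIM('a) = ennreal d" "0 < d"
      by (simp_all add: d_def ennreal_of_nat_eq_real_of_nat)
    have "inverse (ennreal d * ennreal v) = ennreal (inverse (d * v))"
      using v(2) d(2) by (simp add: inverse_ennreal flip: ennreal_mult)
    moreover have "ennreal (inverse (d * v)) * ennreal d = ennreal (inverse v)"
      using v(2) d(2) by (subst ennreal_mult[symmetric]) (auto simp: field_simps)
    ultimately show ?thesis
      unfolding v(1) d(1) mult.assoc[symmetric] using v(2)
      by (simp add: divide_ennreal_def inverse_ennreal mult.commute)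
  qed
  finally show ?thesis .
qed

lemma integrable_compact_support:
  fixes f :: "'a::euclidean_space \<Rightarrow> 'b::{banach, second_countable_topology}"
  assumes "continuous_on UNIV f" and "\<And>x. r \<le> norm x \<Longrightarrow> f x = 0"
  shows "integrable lborel f"
proof -
  have "integrable lborel (\<lambda>x. indicator (cball 0 r) x *\<^sub>R f x)"
    by (rule borel_integrable_compact) (auto intro: continuous_on_subset[OF assms(1)])
  moreover have "(\<lambda>x. indicator (cball 0 r) x *\<^sub>R f x) = f"
    using assms(2) by (auto simp: fun_eq_iff split: split_indicator)
  ultimately show ?thesis by simp
qed

text \<open>The factorisation \<open>f x = norm x ^ d * f (x /\<^sub>R norm x)\<close> separates
  angle from radius. The radial moment is kept as a factor instead of being computed.\<close>

lemma integral_sphere_sigma_homogeneous: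
  fixes f :: "'a::euclidean_space \<Rightarrow> real"
  assumes f: "continuous_on UNIV f" "\<And>x. 0 \<le> f x"
    and hom: "\<And>c x. 0 < c \<Longrightarrow> f (c *\<^sub>R x) = c ^ d * f x" and "0 < d"
    and \<psi>: "continuous_on UNIV \<psi>" "\<And>r. 0 \<le> \<psi> r" "\<And>r. 1 \<le> r \<Longrightarrow> \<psi> r = 0"
  shows "(LINT u|sphere_sigma. f u) * (LINT x|lborel. norm (x::'a) ^ d * \<psi> (norm x)) =
    (LINT x|lborel. f x * \<psi> (norm x))"
proof -
  let ?V = "emeasure lborel (ball 0 1 :: 'a set)"
  define g where "g x = ennreal (f (x /\<^sub>R norm x))" for x
  have [measurable]: "f \<in> borel_measurable borel" "\<psi> \<in> borel_measurable borel"
    using f \<psi> by (auto intro: borel_measurable_continuous_onI)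
  have [measurable]: "g \<in> borel_measurable borel"
    unfolding g_def by measurable
  let ?G = "\<integral>\<^sup>+x. g x * indicator (ball 0 1) x \<partial>lborel"
  have V: "?V \<noteq> \<infinity>" "?V \<noteq> 0"
    using emeasure_lborel_ball_finite[of "0::'a" 1] unit_ball_vol_pos[of "real DIM('a)"]
    by (auto simp: less_top[symmetric] emeasure_ball simp del: unit_ball_vol_pos)
  have "bounded (f ` cball 0 1)"
    using f by (intro compact_imp_bounded compact_continuous_image) (auto intro: continuous_on_subset)
  then obtain M where "\<forall>x\<in>cball 0 1. norm (f x) \<le> M"
    unfolding bounded_iff by blast
  then have M: "f x \<le> M" if "norm x \<le> 1" for x
  proof -
    have "x \<in> cball 0 1"
      using that by simp
    with \<open>\<forall>x\<in>cball 0 1. _\<close> have "norm (f x) \<le> M"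
      by blast
    then show ?thesis by simp
  qed
  have "g x \<le> ennreal M" for x
    unfolding g_def by (intro ennreal_leI M) (simp add: divide_simps)
  then have "?G \<le> (\<integral>\<^sup>+x. ennreal M * indicator (ball 0 1) (x::'a) \<partial>lborel)"
    by (intro nn_integral_mono mult_right_mono) auto
  also have "\<dots> < \<infinity>"
    using V by (simp add: nn_integral_cmult_indicator ennreal_mult_less_top less_top)
  finally have fin: "?G \<noteq> \<infinity>" by simp
  \<comment> \<open>This settles the one point where \<open>x /\<^sub>R norm x\<close> is not a unit
    vector.\<close>
  have f0: "f 0 = 0"
  proof -
    have "f 0 = 2 ^ d * f 0"
      using hom[of 2 0] by simp
    moreover have "(1::real) < 2 ^ d"
      using \<open>0 < d\<close> by (simp add: one_less_power)
    ultimately show ?thesis by auto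
  qed
  have split: "g x * ennreal (norm x ^ d * \<psi> (norm x)) = ennreal (f x * \<psi> (norm x))" for x
  proof (cases "x = 0")
    case False
    have "f x = norm x ^ d * f (x /\<^sub>R norm x)"
      using hom[of "norm x" "x /\<^sub>R norm x"] False by simp
    then show ?thesis
      using f(2) \<psi>(2) by (simp add: g_def mult_ac flip: ennreal_mult)
  qed (simp add: g_def f0 \<open>0 < d\<close>)
  let ?F = "LINT x|lborel. f x * \<psi> (norm x)" and ?N = "LINT x|lborel. norm (x::'a) ^ d * \<psi> (norm x)"
  have \<psi>n: "continuous_on UNIV (\<lambda>x::'a. \<psi> (norm x))"
    by (intro continuous_on_compose2[OF \<psi>(1)] continuous_intros) auto
  have "(\<integral>\<^sup>+x. ennreal (f x * \<psi> (norm x)) \<partial>lborel) = ennreal ?F"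
    using f \<psi> by (intro nn_integral_eq_integral integrable_compact_support[of _ 1] continuous_intros \<psi>n) auto
  moreover have "(\<integral>\<^sup>+x. ennreal (norm (x::'a) ^ d * \<psi> (norm x)) \<partial>lborel) = ennreal ?N"
    using \<psi> by (intro nn_integral_eq_integral integrable_compact_support[of _ 1] continuous_intros \<psi>n) auto
  moreover have "?V * (\<integral>\<^sup>+x. g x * ennreal (norm x ^ d * \<psi> (norm x)) \<partial>lborel) =
      ?G * (\<integral>\<^sup>+x. ennreal (norm (x::'a) ^ d * \<psi> (norm x)) \<partial>lborel)"
    by (rule nn_integral_angular_radial[OF _ _ _ fin, where \<psi>="\<lambda>r. ennreal (r ^ d * \<psi> r)"]) (auto simp: g_def field_simps)
  ultimately have VG: "?V * ennreal ?F = ?G * ennreal ?N"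
    by (simp add: split)
  have "sets (sphere_sigma :: 'a measure) = sets (restrict_space borel (sphere 0 1))"
    by (simp add: sphere_sigma_def surface_measure_def)
  then have meas: "f \<in> borel_measurable sphere_sigma"
    by (simp add: measurable_restrict_space1 cong: measurable_cong_sets)
  have E: "(LINT u|sphere_sigma. f u) = enn2real (?G / ?V)"
    using meas f(2) by (subst integral_eq_nn_integral) (auto simp: nn_integral_sphere_sigma g_def)
  obtain G where G: "?G = ennreal G" "0 \<le> G"
    using fin by (cases ?G) auto
  obtain v where v: "?V = ennreal v" "0 < v"
    using V by (cases ?V) (auto simp: less_le)
  have "0 \<le> ?F" "0 \<le> ?N"
    using f(2) \<psi>(2) by (auto intro!: integral_nonneg_AE)
  then have F: "v * ?F = G * ?N"
    using VG G v by (simp flip: ennreal_mult)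
  have "enn2real (?G / ?V) = G / v"
    using G v by (simp add: divide_ennreal)
  then show ?thesis
    unfolding E by (simp only:) (use F v(2) in \<open>simp add: field_simps\<close>)
qed

section \<open>Integrals of derivatives of compactly supported functions\<close>

text \<open>By translation invariance every difference quotient along \<open>b\<close> integrates to
  zero; dominated convergence passes this on to the derivative.\<close>

lemma integral_directional_derivative_eq_0:
  fixes f :: "'a::euclidean_space \<Rightarrow> 'b::{banach, second_countable_topology}"
  assumes der: "\<And>x. (f has_derivative f' x) (at x)"
    and cont: "continuous_on UNIV (\<lambda>x. f' x b)"
    and supp: "\<And>x. r \<le> norm x \<Longrightarrow> f x = 0"
  shows "has_bochner_integral lborel (\<lambda>x. f' x b) 0"
proof -
  define t where "t n = inverse (real (Suc n))" for n
  have t: "0 < t n" "t n \<le> 1" for n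
    by (auto simp: t_def divide_simps)
  have t0: "t \<longlonglongrightarrow> 0"
    unfolding t_def by (rule LIMSEQ_inverse_real_of_nat)
  \<comment> \<open>The strict inequality leaves an open neighbourhood of \<open>x\<close> on which
    \<open>f\<close> is zero.\<close>
  have supp': "f' x b = 0" if "r < norm x" for x
  proof -
    have "open {x::'a. r < norm x}"
      by (intro open_Collect_less continuous_intros)
    then have "((\<lambda>_. 0) has_derivative f' x) (at x)"
      using that supp by (intro has_derivative_transform_within_open[OF der]) auto
    from has_derivative_unique[OF this has_derivative_const[of 0]] show ?thesis
      by (metis)
  qed
  obtain M where M: "\<And>x. norm (f' x b) \<le> M"
  proof -
    have "bounded ((\<lambda>x. f' x b) ` cball 0 r)"
      using cont by (intro compact_imp_bounded compact_continuous_image) (auto intro: continuous_on_subset)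
    then obtain M where "\<forall>x\<in>cball 0 r. norm (f' x b) \<le> M"
      unfolding bounded_iff by blast
    have "norm (f' x b) \<le> max M 0" for x
      using \<open>\<forall>x\<in>cball 0 r. _\<close> supp'[of x] by (cases "r < norm x") (auto simp: le_max_iff_disj)
    then show ?thesis by (rule that)
  qed
  have "0 \<le> M"
    using M[of 0] norm_ge_zero order_trans by blast
  have line: "((\<lambda>s. f (x + s *\<^sub>R b)) has_derivative (\<lambda>s. s *\<^sub>R f' (x + s0 *\<^sub>R b) b)) (at s0)" for x s0
  proof -
    have "((\<lambda>s. f (x + s *\<^sub>R b)) has_derivative (\<lambda>s. f' (x + s0 *\<^sub>R b) (s *\<^sub>R b))) (at s0)"
      by (rule has_derivative_compose[OF _ der]) (auto intro!: derivative_eq_intros)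
    then show ?thesis
      by (simp add: linear_scale[OF has_derivative_linear[OF der]])
  qed
  have lip: "norm (f (x + s *\<^sub>R b) - f x) \<le> M * \<bar>s\<bar>" for x s
  proof -
    have "norm (f (x + s *\<^sub>R b) - f (x + 0 *\<^sub>R b)) \<le> M * norm (s - 0)"
      by (rule differentiable_bound[where S=UNIV and f="\<lambda>s. f (x + s *\<^sub>R b)"
            and f'="\<lambda>s0 s. s *\<^sub>R f' (x + s0 *\<^sub>R b) b"])
        (auto simp: line mult.commute[of M] intro!: onorm_bound \<open>0 \<le> M\<close> mult_left_mono M)
    then show ?thesis by simp
  qed
  have fc: "continuous_on UNIV f"
    by (rule differentiable_imp_continuous_on) (use der in \<open>auto simp: differentiable_on_def differentiable_def intro: has_derivative_at_withinI\<close>)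
  then have [measurable]: "f \<in> borel_measurable borel"
    by (rule borel_measurable_continuous_onI)
  have [measurable]: "(\<lambda>x. f' x b) \<in> borel_measurable borel"
    using cont by (rule borel_measurable_continuous_onI)
  have int: "integrable lborel f"
    using fc supp by (rule integrable_compact_support)
  have shift: "integrable lborel (\<lambda>x. f (x + c))" "(LINT x|lborel. f (x + c)) = (LINT x|lborel. f x)" for c
  proof -
    have [measurable]: "(+) c \<in> borel_measurable borel" by simp
    show "integrable lborel (\<lambda>x. f (x + c))"
      using int by (subst (asm) lborel_distr_plus[of c, symmetric], subst (asm) integrable_distr_eq) (auto simp: add.commute)
    show "(LINT x|lborel. f (x + c)) = (LINT x|lborel. f x)"
      by (subst (2) lborel_distr_plus[of c, symmetric], subst integral_distr) (auto simp: add.commute)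
  qed
  define s where "s n x = (f (x + t n *\<^sub>R b) - f x) /\<^sub>R t n" for n x
  \<comment> \<open>As \<open>t n \<le> 1\<close>, all quotients vanish outside the ball of radius
    \<open>r + norm b\<close>; inside it they are bounded by \<open>M\<close> through
    \<open>lip\<close>.\<close>
  have "(\<lambda>n. LINT x|lborel. s n x) \<longlonglongrightarrow> (LINT x|lborel. f' x b)"
  proof (rule integral_dominated_convergence[where w="\<lambda>x. indicator (cball 0 (r + norm b)) x *\<^sub>R M"])
    show "integrable lborel (\<lambda>x. indicator (cball 0 (r + norm b)) x *\<^sub>R M)"
      by (rule borel_integrable_compact) auto
    show "AE x in lborel. (\<lambda>n. s n x) \<longlonglongrightarrow> f' x b"
    proof (rule AE_I2)
      fix x
      have "((\<lambda>s. f (x + s *\<^sub>R b)) has_vector_derivative f' x b) (at 0)"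
        using line[of x 0] by (simp add: has_vector_derivative_def)
      then have "(\<lambda>h. norm (f (x + h *\<^sub>R b) - f x - h *\<^sub>R f' x b) / norm h) \<midarrow>0\<rightarrow> 0"
        by (simp add: has_vector_derivative_def has_derivative_at)
      moreover have "filterlim t (at 0) sequentially"
        using t0 t(1) by (auto simp: filterlim_at intro!: always_eventually simp: less_imp_neq[symmetric])
      ultimately have "(\<lambda>n. norm (f (x + t n *\<^sub>R b) - f x - t n *\<^sub>R f' x b) / norm (t n)) \<longlonglongrightarrow> 0"
        by (rule filterlim_compose)
      moreover have "norm (f (x + t n *\<^sub>R b) - f x - t n *\<^sub>R f' x b) / norm (t n) = norm (s n x - f' x b)" for n
      proof -
        have "s n x - f' x b = (f (x + t n *\<^sub>R b) - f x - t n *\<^sub>R f' x b) /\<^sub>R t n"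
          using t(1)[of n] by (simp add: s_def scaleR_diff_right)
        then show ?thesis
          by (simp add: divide_inverse mult.commute)
      qed
      ultimately show "(\<lambda>n. s n x) \<longlonglongrightarrow> f' x b"
        by (simp add: tendsto_norm_zero_iff LIM_zero_iff)
    qed
    show "AE x in lborel. norm (s n x) \<le> indicator (cball 0 (r + norm b)) x *\<^sub>R M" for n
    proof (rule AE_I2)
      fix x
      show "norm (s n x) \<le> indicator (cball 0 (r + norm b)) x *\<^sub>R M"
      proof (cases "norm x \<le> r + norm b")
        case True
        then show ?thesis
          using lip[of x "t n"] t[of n] by (simp add: s_def divide_simps mult.commute)
      next
        case False
        have "norm x \<le> norm (x + t n *\<^sub>R b) + norm (t n *\<^sub>R b)"
          using norm_triangle_ineq4[of "x + t n *\<^sub>R b" "t n *\<^sub>R b"] by simp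
        also have "norm (t n *\<^sub>R b) \<le> norm b"
          using t[of n] by (simp add: mult_left_le_one_le)
        finally have "f (x + t n *\<^sub>R b) = 0" "f x = 0"
          using False norm_ge_zero[of b] by (intro supp; linarith)+
        then show ?thesis using False by (simp add: s_def)
      qed
    qed
  qed (auto simp: s_def)
  moreover have "(LINT x|lborel. s n x) = 0" for n
    unfolding s_def using int shift by simp
  ultimately have "(LINT x|lborel. f' x b) = 0"
    by (simp add: LIMSEQ_const_iff)
  \<comment> \<open>The radius is \<open>r + 1\<close> because \<open>supp'\<close> is silent on the
    sphere of radius \<open>r\<close>.\<close>
  moreover have "integrable lborel (\<lambda>x. f' x b)"
    using cont supp' by (intro integrable_compact_support[of _ "r + 1"]) auto
  ultimately show ?thesis
    by (simp add: has_bochner_integral_iff)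
qed

section \<open>Positive semidefinite square roots\<close>

lemma cinner_add_left: "cinner (u + v) w = cinner u w + cinner v w"
  and cinner_add_right: "cinner w (u + v) = cinner w u + cinner w v"
  by (simp_all add: cinner_def algebra_simps sum.distrib)

lemma cinner_scale_left: "cinner (c *s u) v = c * cinner u v"
  and cinner_scale_right: "cinner u (c *s v) = cnj c * cinner u v"
  by (simp_all add: cinner_def sum_distrib_left mult_ac)

lemma cnj_cinner: "cnj (cinner u v) = cinner v u"
  by (simp add: cinner_def mult.commute)

lemma cinner_axis_right: "cinner u (axis i 1) = u $ i"
  and cinner_axis_right_ii: "cinner u (axis i \<i>) = - \<i> * u $ i"
  by (simp_all add: cinner_def axis_def if_distrib if_distribR cong: if_cong)

lemma cinner_self: "cinner u u = complex_of_real ((norm u)\<^sup>2)"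
  by (simp add: cinner_def norm_vec_def L2_set_def complex_norm_square[symmetric] sum_nonneg)

lemma cinner_self_eq_0_iff: "cinner u u = 0 \<longleftrightarrow> u = 0"
  by (simp add: cinner_self)

lemma cinner_zero [simp]: "cinner 0 u = 0" "cinner u 0 = 0"
  by (simp_all add: cinner_def)

lemma cinner_matrix_left: "cinner (B *v u) v = cinner u (ctranspose B *v v)"
proof -
  have "cinner (B *v u) v = (\<Sum>i\<in>UNIV. \<Sum>j\<in>UNIV. B $ i $ j * u $ j * cnj (v $ i))"
    by (simp add: cinner_def matrix_vector_mult_def sum_distrib_right)
  also have "\<dots> = (\<Sum>j\<in>UNIV. \<Sum>i\<in>UNIV. B $ i $ j * u $ j * cnj (v $ i))"
    by (rule sum.swap)
  also have "\<dots> = cinner u (ctranspose B *v v)"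
    by (simp add: cinner_def matrix_vector_mult_def ctranspose_def sum_distrib_left mult_ac)
  finally show ?thesis .
qed

lemma ctranspose_ctranspose [simp]: "ctranspose (ctranspose A) = A"
  by (simp add: ctranspose_def vec_eq_iff)

lemma ctranspose_matrix_mult: "ctranspose (A ** B) = ctranspose B ** ctranspose A"
  by (simp add: ctranspose_def matrix_matrix_mult_def vec_eq_iff mult.commute)

lemma ctranspose_diff: "ctranspose (A - B) = ctranspose A - ctranspose B"
  by (simp add: ctranspose_def vec_eq_iff)

lemma trace_ctranspose: "trace (ctranspose A) = cnj (trace A)"
  by (simp add: trace_def ctranspose_def)

lemma mat_pow_2: "mat_pow A 2 = A ** A"
  by (simp add: numeral_2_eq_2)

lemma mat_pow_4: "mat_pow A 4 = mat_pow A 2 ** mat_pow A 2"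
  by (simp add: eval_nat_numeral matrix_mul_assoc)

lemma ctranspose_mat_pow_2: "ctranspose (mat_pow A 2) = mat_pow (ctranspose A) 2"
  by (simp add: mat_pow_2 ctranspose_matrix_mult)

lemma trace_mult_ctranspose: "trace (A ** ctranspose A) = complex_of_real ((frobenius_norm A)\<^sup>2)"
  by (simp add: trace_def matrix_matrix_mult_def ctranspose_def frobenius_norm_def sum_nonneg
      complex_norm_square[symmetric])

lemma trace_ctranspose_mult: "trace (ctranspose A ** A) = complex_of_real ((frobenius_norm A)\<^sup>2)"
  by (subst trace_mul_sym) (rule trace_mult_ctranspose)

lemma matrix_vector_axis: "(M *v axis j 1) $ i = M $ i $ j" for M :: "complex^'n^'m"
  by (simp add: matrix_vector_mult_def axis_def if_distrib cong: if_cong)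

lemma matrix_mult_diff: "A ** (B - C) = A ** B - A ** C" "(B - C) ** A = B ** A - C ** A"
  for A B C :: "complex^'n^'n"
  by (simp_all add: matrix_matrix_mult_def vec_eq_iff algebra_simps sum_subtractf)

text \<open>Polarisation over the complex field: testing with \<open>w\<close> and with
  \<open>\<i> *s w\<close> separates the two cross terms.\<close>

lemma quadratic_form_eq_0:
  assumes "\<And>v. cinner (C *v v) v = 0"
  shows "C = 0"
proof -
  have "cinner (C *v v) w = 0" for v w
  proof -
    have "cinner (C *v v) w' + cinner (C *v w') v = 0" for w'
      using assms[of "v + w'"] assms[of v] assms[of w']
      by (simp add: add.commute matrix_vector_right_distrib cinner_add_left cinner_add_right)
    from this[of w] this[of "\<i> *s w"] show ?thesis
      by (simp add: vector_scalar_commute cinner_scale_left cinner_scale_right algebra_simps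
          add_eq_0_iff)
  qed
  then have "C *v v = 0" for v
    using cinner_self_eq_0_iff by blast
  then show ?thesis
    by (simp add: matrix_eq)
qed

text \<open>Moving from \<open>x\<close> in the direction \<open>y = X *v x\<close> by
  \<open>t\<close> gives the form the value \<open>2 * t * a + t\<^sup>2 * c\<close>; a positive
  \<open>a\<close> would make this negative for small negative \<open>t\<close>.\<close>

lemma pos_semidef_form_eq_0D:
  assumes X: "pos_semidef X" and x: "Re (cinner (X *v x) x) = 0"
  shows "X *v x = 0"
proof -
  define y where "y = X *v x"
  define a c where "a = (norm y)\<^sup>2" and "c = Re (cinner (X *v y) y)"
  have herm: "ctranspose X = X" and pos: "\<And>z. 0 \<le> Re (cinner (X *v z) z)"
    using X by (auto simp: pos_semidef_def)
  have "cinner (X *v y) x = cinner y y"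
    by (subst cinner_matrix_left) (simp add: herm y_def)
  then have "Re (cinner (X *v (x + complex_of_real t *s y)) (x + complex_of_real t *s y)) = 2 * t * a + t\<^sup>2 * c" for t
    using x by (simp add: matrix_vector_right_distrib vector_scalar_commute cinner_add_left cinner_add_right
        cinner_scale_left cinner_scale_right flip: y_def) (simp add: cinner_self a_def c_def power2_eq_square algebra_simps)
  then have q: "0 \<le> 2 * t * a + t\<^sup>2 * c" for t
    using pos by metis
  have "0 \<le> c"
    using pos by (simp add: c_def)
  \<comment> \<open>Here the form takes the value \<open>- t\<^sup>2 * (c + 2)\<close>; the summand
    1 keeps the denominator positive when \<open>c = 0\<close>.\<close>
  define t where "t = - a / (c + 1)"
  have "a = - t * (c + 1)"
    using \<open>0 \<le> c\<close> by (simp add: t_def)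
  with q[of t] have "t\<^sup>2 * (c + 2) \<le> 0"
    by (simp add: power2_eq_square algebra_simps)
  then have "t = 0"
    using \<open>0 \<le> c\<close> by (auto simp: mult_le_0_iff)
  then have "a = 0"
    using \<open>a = - t * (c + 1)\<close> by simp
  then show ?thesis
    by (simp add: a_def y_def)
qed

text \<open>For positive semidefinite \<open>X\<close> this exhibits the trace as a sum of
  nonnegative terms, one for each column of \<open>D\<close>.\<close>

lemma trace_sandwich:
  "trace (ctranspose D ** X ** D) = (\<Sum>i\<in>UNIV. cinner (X *v (D *v axis i 1)) (D *v axis i 1))"
proof -
  have "trace M = (\<Sum>i\<in>UNIV. cinner (M *v axis i 1) (axis i 1))" for M :: "complex^'a^'a"
    by (simp add: trace_def cinner_axis_right matrix_vector_axis)
  from this[of "ctranspose D ** X ** D"] show ?thesis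
    by (simp add: cinner_matrix_left[of "ctranspose D"] flip: matrix_vector_mul_assoc)
qed

text \<open>With \<open>D = B - C\<close>, equal squares give \<open>B ** D + D ** C = 0\<close>.
  Multiplying by \<open>D\<close> and taking the trace yields a vanishing sum of nonnegative terms,
  so \<open>B\<close> and \<open>C\<close> both annihilate every column of \<open>D\<close>.\<close>

lemma pos_semidef_sqrt_unique:
  assumes B: "pos_semidef B" and C: "pos_semidef C" and eq: "mat_pow B 2 = mat_pow C 2"
  shows "B = C"
proof -
  define D where "D = B - C"
  have D: "ctranspose D = D"
    using B C by (simp add: D_def ctranspose_diff pos_semidef_def)
  have "B ** D + D ** C = 0"
    using eq by (simp add: D_def mat_pow_2 matrix_mult_diff)
  then have "trace (D ** (B ** D + D ** C)) = 0"
    by (simp add: trace_def)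
  moreover have "trace (D ** D ** C) = trace (D ** C ** D)"
    using trace_mul_sym[of D "D ** C"] by (simp add: matrix_mul_assoc)
  ultimately have "trace (D ** B ** D) + trace (D ** C ** D) = 0"
    by (simp add: matrix_add_ldistrib trace_add matrix_mul_assoc)
  then have *: "(\<Sum>i\<in>UNIV. Re (cinner (B *v (D *v axis i 1)) (D *v axis i 1))
      + Re (cinner (C *v (D *v axis i 1)) (D *v axis i 1))) = 0"
    using trace_sandwich[of D B] trace_sandwich[of D C] unfolding D
    by (simp add: sum.distrib complex_eq_iff)
  have col: "D *v axis i 1 = 0" for i
  proof -
    have nn: "0 \<le> Re (cinner (B *v x) x)" "0 \<le> Re (cinner (C *v x) x)" for x
      using B C by (auto simp: pos_semidef_def)
    then have "Re (cinner (B *v (D *v axis i 1)) (D *v axis i 1))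
      + Re (cinner (C *v (D *v axis i 1)) (D *v axis i 1)) = 0"
      using * by (subst (asm) sum_nonneg_eq_0_iff) auto
    then have "B *v (D *v axis i 1) = 0" "C *v (D *v axis i 1) = 0"
      using nn[of "D *v axis i 1"] pos_semidef_form_eq_0D[OF B] pos_semidef_form_eq_0D[OF C] by auto
    \<comment> \<open>Since \<open>D\<close> is hermitian, this makes the squared norm of the column
      zero.\<close>
    then have "D *v (D *v axis i 1) = 0"
      by (simp add: D_def matrix_vector_mult_diff_rdistrib)
    then have "cinner (D *v axis i 1) (D *v axis i 1) = 0"
      by (subst cinner_matrix_left) (simp add: D)
    then show ?thesis
      by (simp add: cinner_self_eq_0_iff)
  qed
  have "D $ i $ j = 0" for i j
    using col[of j] by (simp add: matrix_vector_axis vec_eq_iff)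
  then have "D = 0"
    by (simp add: vec_eq_iff)
  then show ?thesis
    by (simp add: D_def)
qed

text \<open>Finitely many continuous equations in the entries define a closed set, and unit columns
  bound every entry by 1.\<close>

lemma compact_unitary: "compact {U :: complex^'n^'n. ctranspose U ** U = mat 1}"
proof -
  let ?S = "{U :: complex^'n^'n. ctranspose U ** U = mat 1}"
  have "?S = (\<Inter>i. \<Inter>j. {U. (\<Sum>k\<in>UNIV. cnj (U $ k $ i) * U $ k $ j) = mat 1 $ i $ j})"
    by (auto simp: vec_eq_iff matrix_matrix_mult_def ctranspose_def)
  then have "closed ?S"
    by (auto intro!: closed_INT closed_Collect_eq continuous_intros)
  moreover have "norm U \<le> (\<Sum>i\<in>(UNIV::'n set). \<Sum>j\<in>(UNIV::'n set). 1)" if "U \<in> ?S" for U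
  proof -
    have "(cmod (U $ i $ j))\<^sup>2 \<le> 1\<^sup>2" for i j
    proof -
      have "complex_of_real (\<Sum>k\<in>UNIV. (cmod (U $ k $ j))\<^sup>2) = (ctranspose U ** U) $ j $ j"
        by (simp add: matrix_matrix_mult_def ctranspose_def complex_norm_square[symmetric] mult.commute[of "cnj _"])
      also have "\<dots> = complex_of_real 1"
        using that by (simp add: mat_def)
      finally have "(\<Sum>k\<in>UNIV. (cmod (U $ k $ j))\<^sup>2) = 1"
        unfolding of_real_eq_iff .
      moreover have "(cmod (U $ i $ j))\<^sup>2 \<le> (\<Sum>k\<in>UNIV. (cmod (U $ k $ j))\<^sup>2)"
        by (rule member_le_sum) auto
      ultimately show ?thesis by simp
    qed
    then have 1: "cmod (U $ i $ j) \<le> 1" for i j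
      by (rule power2_le_imp_le) simp
    have "norm U \<le> (\<Sum>i\<in>UNIV. norm (U $ i))"
      unfolding norm_vec_def by (rule L2_set_le_sum) simp
    also have "\<dots> \<le> (\<Sum>i\<in>UNIV. \<Sum>j\<in>UNIV. cmod (U $ i $ j))"
      unfolding norm_vec_def[of "U $ _"] by (intro sum_mono L2_set_le_sum) simp
    also have "\<dots> \<le> (\<Sum>i\<in>(UNIV::'n set). \<Sum>j\<in>(UNIV::'n set). 1)"
      by (intro sum_mono 1)
    finally show ?thesis .
  qed
  then have "bounded ?S"
    unfolding bounded_iff by blast
  ultimately show ?thesis
    by (simp add: compact_eq_bounded_closed)
qed

text \<open>For a unit vector \<open>v\<close>, this multiplies the component along \<open>v\<close>
  by \<open>z\<close> and fixes the orthogonal complement.\<close>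

definition cphase :: "complex \<Rightarrow> complex^'n \<Rightarrow> complex^'n^'n" where
  "cphase z v = (\<chi> i j. mat 1 $ i $ j + (z - 1) * v $ i * cnj (v $ j))"

lemma cphase_mult_vec: "cphase z v *v x = x + ((z - 1) * cinner x v) *s v"
  by (simp add: cphase_def matrix_vector_mult_def vec_eq_iff mat_def distrib_right sum.distrib
      cinner_def sum_distrib_left sum_distrib_right if_distrib[of "\<lambda>x. x * _"] cong: if_cong)
    (simp add: mult_ac)

lemma ctranspose_cphase: "ctranspose (cphase z v) = cphase (cnj z) v"
  by (auto simp: cphase_def ctranspose_def vec_eq_iff mat_def mult_ac)

text \<open>The adjoint is the phase with \<open>cnj z\<close>, and
  \<open>(z - 1) + (cnj z - 1) * z = cnj z * z - 1\<close> vanishes.\<close>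

lemma unitary_cphase:
  assumes "cmod z = 1" "cinner v v = 1"
  shows "ctranspose (cphase z v) ** cphase z v = mat 1"
proof -
  have "cnj z * z = 1"
    using assms(1) by (simp add: complex_norm_square[symmetric] mult.commute[of "cnj z"])
  then have "(z - 1) * c + (cnj z - 1) * (c + (z - 1) * c) = 0" for c
    by (simp add: algebra_simps) 
  then have "(cphase (cnj z) v ** cphase z v) *v x = x" for x
    by (simp add: cphase_mult_vec assms(2) cinner_add_left cinner_scale_left vec_eq_iff
        flip: matrix_vector_mul_assoc distrib_right)
  then show ?thesis
    by (simp add: ctranspose_cphase matrix_eq)
qed

lemma trace_cphase_mult: "trace (cphase z v ** B) = trace B + (z - 1) * cinner (B *v v) v"
proof -
  have "trace (cphase z v ** B) = trace B + (\<Sum>i\<in>UNIV. \<Sum>j\<in>UNIV. (z - 1) * v $ i * cnj (v $ j) * B $ j $ i)"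
    by (simp add: trace_def matrix_matrix_mult_def cphase_def mat_def distrib_right sum.distrib if_distrib[of "\<lambda>x. x * _"] cong: if_cong)
  also have "(\<Sum>i\<in>UNIV. \<Sum>j\<in>UNIV. (z - 1) * v $ i * cnj (v $ j) * B $ j $ i) =
     (\<Sum>j\<in>UNIV. \<Sum>i\<in>UNIV. (z - 1) * v $ i * cnj (v $ j) * B $ j $ i)"
    by (rule sum.swap)
  also have "\<dots> = (z - 1) * cinner (B *v v) v"
    by (simp add: cinner_def matrix_vector_mult_def sum_distrib_left sum_distrib_right mult_ac)
  finally show ?thesis .
qed

text \<open>A maximiser \<open>U\<close> of \<open>Re (tr (U A))\<close> over the unitary group makes \<open>U A\<close> positive semidefinite,
  as perturbing \<open>U\<close> by a phase along any unit vector shows. This avoids the spectral theorem.\<close>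

lemma pos_semidef_sqrt_exists:
  fixes A :: "complex^'n^'n"
  shows "\<exists>B. pos_semidef B \<and> mat_pow B 2 = ctranspose A ** A"
proof -
  let ?S = "{U :: complex^'n^'n. ctranspose U ** U = mat 1}"
  have "mat 1 \<in> ?S"
    by (auto simp: ctranspose_def mat_def matrix_matrix_mult_def vec_eq_iff if_distrib if_distribR cong: if_cong)
  moreover have "continuous_on ?S (\<lambda>U. Re (trace (U ** A)))"
    unfolding trace_def matrix_matrix_mult_def by (auto intro!: continuous_intros)
  ultimately obtain U where U: "ctranspose U ** U = mat 1"
    and max: "\<And>V. ctranspose V ** V = mat 1 \<Longrightarrow> Re (trace (V ** A)) \<le> Re (trace (U ** A))"
    using continuous_attains_sup[OF compact_unitary, of "\<lambda>U. Re (trace (U ** A))"] by blast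
  define B where "B = U ** A"
  have form: "cinner (B *v v) v = complex_of_real (cmod (cinner (B *v v) v))" for v
  proof (cases "v = 0")
    case False
    define v1 where "v1 = complex_of_real (1 / norm v) *s v"
    define w where "w = cinner (B *v v1) v1"
    have v1: "cinner v1 v1 = 1"
      using False unfolding v1_def cinner_scale_left cinner_scale_right
      unfolding cinner_self
      by (simp add: power2_eq_square)
    \<comment> \<open>The competitor \<open>cphase z v1 ** U\<close> is unitary, and it changes the
      trace by \<open>(z - 1) * w\<close>.\<close>
    have "Re ((z - 1) * w) \<le> 0" if "cmod z = 1" for z
    proof -
      have "ctranspose (cphase z v1 ** U) ** (cphase z v1 ** U) =
          ctranspose U ** (ctranspose (cphase z v1) ** cphase z v1) ** U"
        by (simp add: ctranspose_matrix_mult matrix_mul_assoc)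
      also have "\<dots> = mat 1"
        by (simp add: unitary_cphase[OF that v1] U)
      finally have "Re (trace (cphase z v1 ** B)) \<le> Re (trace B)"
        using max by (simp add: B_def matrix_mul_assoc)
      then show ?thesis
        by (simp add: trace_cphase_mult w_def)
    qed
    \<comment> \<open>This phase rotates \<open>w\<close> onto \<open>cmod w\<close>, which forces
      \<open>w\<close> to be real and nonnegative.\<close>
    from this[of "cnj w / cmod w"] have "cmod w \<le> Re w"
      by (cases "w = 0") (auto simp: norm_divide algebra_simps complex_norm_square[symmetric] power2_eq_square)
    then have w: "w = complex_of_real (cmod w)"
      by (smt (verit) complex_Re_le_cmod complex_eq_iff complex_of_real_def cmod_eq_Re cmod_power2 complex.sel power2_eq_square Re_complex_of_real Im_complex_of_real zero_eq_power2 power_zero_numeral)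
    have "v = complex_of_real (norm v) *s v1"
      using False by (simp add: v1_def vec_eq_iff)
    then have "cinner (B *v v) v = complex_of_real ((norm v)\<^sup>2) * w"
      by (metis (no_types, lifting) cinner_scale_left cinner_scale_right complex_cnj_complex_of_real
          mult.assoc of_real_mult power2_eq_square vector_scalar_commute w_def)
    then show ?thesis
      using w by (metis norm_ge_zero norm_mult norm_of_real of_real_mult abs_norm_cancel abs_power2)
  qed simp
  \<comment> \<open>A form with real values agrees with that of the adjoint; polarisation then makes
    \<open>B\<close> hermitian.\<close>
  have "cinner ((B - ctranspose B) *v v) v = 0" for v
  proof -
    have "cinner (ctranspose B *v v) v = cnj (cinner (B *v v) v)"
      by (simp add: cinner_matrix_left cnj_cinner)
    also have "\<dots> = cinner (B *v v) v"
      by (metis form complex_cnj_complex_of_real)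
    finally show ?thesis
      by (simp add: matrix_vector_mult_diff_rdistrib cinner_def left_diff_distrib sum_subtractf)
  qed
  then have herm: "ctranspose B = B"
    using quadratic_form_eq_0[of "B - ctranspose B"] by simp
  moreover have "0 \<le> Re (cinner (B *v v) v)" for v
    by (subst form) simp
  ultimately have "pos_semidef B"
    by (simp add: pos_semidef_def)
  moreover have "mat_pow B 2 = ctranspose B ** B"
    by (simp add: mat_pow_2 herm)
  moreover have "\<dots> = ctranspose A ** (ctranspose U ** U) ** A"
    by (simp add: B_def ctranspose_matrix_mult matrix_mul_assoc)
  ultimately show ?thesis
    by (auto simp: U)
qed

text \<open>Existence and uniqueness of the root make the description in \<open>mat_sqrt\<close>
  proper.\<close>

lemma mat_abs_squared: "mat_pow (mat_abs A) 2 = ctranspose A ** A"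
proof -
  have "\<exists>!B. pos_semidef B \<and> mat_pow B 2 = ctranspose A ** A"
    using pos_semidef_sqrt_exists pos_semidef_sqrt_unique by metis
  from theI'[OF this] show ?thesis
    by (simp add: mat_abs_def mat_sqrt_def)
qed

text \<open>The trace is the squared Frobenius norm of the hermitian matrix
  \<open>ctranspose A ** A\<close>, hence real and nonnegative, so \<open>Re\<close> and
  \<open>root 4\<close> can be undone.\<close>

lemma schatten4_norm_power4:
  "complex_of_real (schatten4_norm A ^ 4) = trace (mat_pow (ctranspose A ** A) 2)"
proof -
  let ?P = "ctranspose A ** A"
  have "ctranspose ?P = ?P"
    by (simp add: ctranspose_matrix_mult)
  then have "trace (mat_pow ?P 2) = complex_of_real ((frobenius_norm ?P)\<^sup>2)"
    using trace_mult_ctranspose[of ?P] by (simp add: mat_pow_2)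
  then show ?thesis
    by (simp add: schatten4_norm_def mat_pow_4 mat_abs_squared flip: mat_pow_2[of ?P])
qed

section \<open>Integration by parts in Wirtinger derivatives\<close>

lemma bounded_bilinear_cinner: "bounded_bilinear (cinner :: complex^'n \<Rightarrow> complex^'n \<Rightarrow> complex)"
proof -
  have "cinner (r *\<^sub>R u) v = r *\<^sub>R cinner u v" "cinner u (r *\<^sub>R v) = r *\<^sub>R cinner u v"
    for r and u v :: "complex^'n"
    by (simp_all add: cinner_def scaleR_sum_right)
  then have "bilinear (cinner :: complex^'n \<Rightarrow> complex^'n \<Rightarrow> complex)"
    by (auto simp: bilinear_def intro!: linearI cinner_add_left cinner_add_right)
  then show ?thesis
    by (simp add: bilinear_conv_bounded_bilinear)
qed

lemmas continuous_on_cinner [continuous_intros] =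
  bounded_bilinear.continuous_on[OF bounded_bilinear_cinner]

lemma bounded_linear_matrix_vector_mult: "bounded_linear ((*v) (B :: complex^'n^'m))"
  by (simp add: linear_conv_bounded_linear[symmetric])

lemmas continuous_on_matrix_vector_mult [continuous_intros] =
  bounded_linear.continuous_on[OF bounded_linear_matrix_vector_mult]

text \<open>Component \<open>q\<close> of \<open>dF\<close> is the Wirtinger derivative \<open>\<partial>F / \<partial>(cnj u\<^sub>q)\<close>.\<close>

definition has_dbar :: "(complex^'n \<Rightarrow> complex) \<Rightarrow> (complex^'n \<Rightarrow> complex^'n) \<Rightarrow> bool" where
  "has_dbar F dF \<longleftrightarrow> (\<exists>L. (\<forall>u. (F has_derivative L u) (at u)) \<and>
     (\<forall>v. continuous_on UNIV (\<lambda>u. L u v)) \<and>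
     (\<forall>u q. L u (axis q 1) + \<i> * L u (axis q \<i>) = 2 * dF u $ q))"

lemma has_dbarI:
  assumes "\<And>u. (F has_derivative L u) (at u)" "\<And>v. continuous_on UNIV (\<lambda>u. L u v)"
    "\<And>u q. L u (axis q 1) + \<i> * L u (axis q \<i>) = 2 * dF u $ q"
  shows "has_dbar F dF"
  using assms unfolding has_dbar_def by blast

lemma has_dbar_imp_continuous:
  assumes "has_dbar F dF"
  shows "continuous_on UNIV F" "continuous_on UNIV dF"
proof -
  obtain L where L: "\<And>u. (F has_derivative L u) (at u)" "\<And>v. continuous_on UNIV (\<lambda>u. L u v)"
    "\<And>u q. L u (axis q 1) + \<i> * L u (axis q \<i>) = 2 * dF u $ q"
    using assms unfolding has_dbar_def by blast
  show "continuous_on UNIV F"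
    using L(1) by (meson has_derivative_continuous continuous_at_imp_continuous_on)
  have "continuous_on UNIV (\<lambda>u. (L u (axis q 1) + \<i> * L u (axis q \<i>)) / 2)" for q
    by (intro continuous_intros L(2)) auto
  then have "continuous_on UNIV (\<lambda>u. \<chi> q. dF u $ q)"
    by (intro continuous_on_vec_lambda) (simp add: L(3))
  then show "continuous_on UNIV dF"
    by simp
qed

lemma has_dbar_const: "has_dbar (\<lambda>_. c) (\<lambda>_. 0)"
  by (rule has_dbarI[where L="\<lambda>_ _. 0"]) (auto intro: derivative_eq_intros)

lemma has_dbar_mult:
  assumes "has_dbar F dF" "has_dbar G dG"
  shows "has_dbar (\<lambda>u. F u * G u) (\<lambda>u. F u *s dG u + G u *s dF u)"
proof -
  obtain L where L: "\<And>u. (F has_derivative L u) (at u)" "\<And>v. continuous_on UNIV (\<lambda>u. L u v)"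
    "\<And>u q. L u (axis q 1) + \<i> * L u (axis q \<i>) = 2 * dF u $ q"
    using assms(1) unfolding has_dbar_def by blast
  obtain K where K: "\<And>u. (G has_derivative K u) (at u)" "\<And>v. continuous_on UNIV (\<lambda>u. K u v)"
    "\<And>u q. K u (axis q 1) + \<i> * K u (axis q \<i>) = 2 * dG u $ q"
    using assms(2) unfolding has_dbar_def by blast
  show ?thesis
  proof (rule has_dbarI[where L="\<lambda>u v. F u * K u v + L u v * G u"])
    show "F u * K u (axis q 1) + L u (axis q 1) * G u + \<i> * (F u * K u (axis q \<i>) + L u (axis q \<i>) * G u)
      = 2 * (F u *s dG u + G u *s dF u) $ q" for u q
    proof -
      have "F u * K u (axis q 1) + L u (axis q 1) * G u + \<i> * (F u * K u (axis q \<i>) + L u (axis q \<i>) * G u)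
        = F u * (K u (axis q 1) + \<i> * K u (axis q \<i>)) + G u * (L u (axis q 1) + \<i> * L u (axis q \<i>))"
        by (simp add: algebra_simps)
      then show ?thesis
        by (simp add: L(3) K(3))
    qed
  qed (auto intro!: has_derivative_mult L K continuous_intros
      has_dbar_imp_continuous(1)[OF assms(1)] has_dbar_imp_continuous(1)[OF assms(2)])
qed

lemma has_dbar_cinner: "has_dbar (\<lambda>u. cinner a u) (\<lambda>_. a)"
proof (rule has_dbarI[where L="\<lambda>_ v. cinner a v"])
  show "(cinner a has_derivative cinner a) (at u)" for u
    by (intro bounded_linear_imp_has_derivative bounded_bilinear.bounded_linear_right bounded_bilinear_cinner)
qed (auto simp: cinner_axis_right cinner_axis_right_ii algebra_simps)

text \<open>The first slot is holomorphic in \<open>u\<close> and contributes nothing; the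
  conjugated slot contributes \<open>B *v u\<close>.\<close>

lemma has_dbar_quadratic_form: "has_dbar (\<lambda>u. cinner (B *v u) u) (\<lambda>u. B *v u)"
proof (rule has_dbarI[where L="\<lambda>u v. cinner (B *v u) v + cinner (B *v v) u"])
  show "((\<lambda>u. cinner (B *v u) u) has_derivative (\<lambda>v. cinner (B *v u) v + cinner (B *v v) u)) (at u)" for u
    by (intro bounded_bilinear.FDERIV[OF bounded_bilinear_cinner] bounded_linear_imp_has_derivative
        bounded_linear_matrix_vector_mult has_derivative_ident)
  have "axis q \<i> = \<i> *s (axis q 1 :: complex^'a)" for q :: 'a
    by (simp add: vec_eq_iff axis_def)
  then show "cinner (B *v u) (axis q 1) + cinner (B *v axis q 1) u +
      \<i> * (cinner (B *v u) (axis q \<i>) + cinner (B *v axis q \<i>) u) = 2 * (B *v u) $ q" for u q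
    by (simp add: vector_scalar_commute cinner_scale_left cinner_scale_right cinner_axis_right algebra_simps)
qed (auto intro!: continuous_intros)

section \<open>Weights on the unit ball\<close>

text \<open>For \<open>0 < j\<close> this is the ball weight \<open>w\<^sub>j\<close> extended by
  zero; for \<open>j = 0\<close> it is constantly 1, hence the recurring assumption
  \<open>0 < j\<close>.\<close>

definition bump :: "nat \<Rightarrow> complex^'n \<Rightarrow> complex" where
  "bump j u = complex_of_real (max 0 (1 - (norm u)\<^sup>2) ^ j)"

lemma continuous_bump: "continuous_on UNIV (bump j)"
  unfolding bump_def by (intro continuous_intros)

text \<open>Only \<open>t = 0\<close> is delicate: the difference quotient there is
  \<open>max 0 h ^ j\<close>, which tends to 0 because \<open>0 < j\<close>.\<close>

lemma DERIV_max_0_power: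
  assumes "0 < j"
  shows "((\<lambda>t::real. max 0 t ^ Suc j) has_field_derivative real (Suc j) * max 0 t ^ j) (at t)"
proof -
  consider "t < 0" | "t = 0" | "t > 0" by linarith
  then show ?thesis
  proof cases
    case 1
    have "((\<lambda>_::real. 0) has_field_derivative 0) (at t)" by simp
    then have "((\<lambda>t::real. max 0 t ^ Suc j) has_field_derivative 0) (at t)"
      by (rule has_field_derivative_transform_within_open[where S="{..<0}"]) (use 1 in auto)
    moreover have "real (Suc j) * max 0 t ^ j = 0" using 1 assms by simp
    ultimately show ?thesis by (simp only:)
  next
    case 2
    have "isCont (\<lambda>h::real. max 0 h ^ j) 0"
      by (intro continuous_intros)
    moreover have "max 0 (0::real) ^ j = 0"
      using assms by simp
    ultimately have "((\<lambda>h::real. max 0 h ^ j) \<longlongrightarrow> 0) (at 0)"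
      by (simp only: isCont_def)
    moreover have "\<forall>\<^sub>F h in at 0. max 0 h ^ j = (max 0 (0 + h) ^ Suc j - max 0 (0::real) ^ Suc j) / h"
      using assms by (auto simp: eventually_at max_def intro!: exI[of _ 1])
    ultimately have "((\<lambda>h::real. (max 0 (0 + h) ^ Suc j - max 0 0 ^ Suc j) / h) \<longlongrightarrow> 0) (at 0)"
      by (rule Lim_transform_eventually)
    then have "((\<lambda>t::real. max 0 t ^ Suc j) has_field_derivative 0) (at t)"
      using 2 by (simp add: DERIV_def)
    moreover have "real (Suc j) * max 0 t ^ j = 0" using 2 assms by simp
    ultimately show ?thesis by (simp only:)
  next
    case 3
    have "((\<lambda>t::real. t ^ Suc j) has_field_derivative real (Suc j) * t ^ j) (at t)"
      using DERIV_pow[of "Suc j" t] by simp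
    then have "((\<lambda>t::real. max 0 t ^ Suc j) has_field_derivative real (Suc j) * t ^ j) (at t)"
      by (rule has_field_derivative_transform_within_open[where S="{0<..}"]) (use 3 in auto)
    moreover have "max 0 t = t" using 3 by simp
    ultimately show ?thesis by simp
  qed
qed

lemma has_dbar_bump:
  assumes "0 < j"
  shows "has_dbar (bump (Suc j)) (\<lambda>u. (- of_nat (Suc j) * bump j u) *s u)"
proof (rule has_dbarI[where L="\<lambda>u v. complex_of_real (- 2 * (u \<bullet> v) * (real (Suc j) * max 0 (1 - (norm u)\<^sup>2) ^ j))"])
  fix u :: "complex^'a"
  have "((\<lambda>u. 1 - (norm u)\<^sup>2) has_derivative (\<lambda>v. - 2 * (u \<bullet> v))) (at u)"
    unfolding power2_norm_eq_inner
    by (auto intro!: derivative_eq_intros simp: inner_commute)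
  from has_derivative_compose[OF this DERIV_max_0_power[OF assms, unfolded has_field_derivative_def]]
  have "((\<lambda>u. max 0 (1 - (norm u)\<^sup>2) ^ Suc j) has_derivative
      (\<lambda>v. - 2 * (u \<bullet> v) * (real (Suc j) * max 0 (1 - (norm u)\<^sup>2) ^ j))) (at u)"
    by (simp add: mult_ac)
  then show "(bump (Suc j) has_derivative
      (\<lambda>v. complex_of_real (- 2 * (u \<bullet> v) * (real (Suc j) * max 0 (1 - (norm u)\<^sup>2) ^ j)))) (at u)"
    unfolding bump_def by (rule has_derivative_of_real)
next
  fix u :: "complex^'a" and q
  \<comment> \<open>The two real directions at coordinate \<open>q\<close> pick out the real and the
    imaginary part of \<open>u $ q\<close>.\<close>
  have "complex_of_real (u \<bullet> axis q 1) + \<i> * complex_of_real (u \<bullet> axis q \<i>) = u $ q"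
    by (simp add: inner_axis inner_complex_def complex_eq_iff)
  then have "2 * ((- of_nat (Suc j) * bump j u) *s u) $ q = - 2 * of_nat (Suc j) * bump j u *
      (complex_of_real (u \<bullet> axis q 1) + \<i> * complex_of_real (u \<bullet> axis q \<i>))"
    by simp
  then show "complex_of_real (- 2 * (u \<bullet> axis q 1) * (real (Suc j) * max 0 (1 - (norm u)\<^sup>2) ^ j)) +
      \<i> * complex_of_real (- 2 * (u \<bullet> axis q \<i>) * (real (Suc j) * max 0 (1 - (norm u)\<^sup>2) ^ j)) =
      2 * ((- of_nat (Suc j) * bump j u) *s u) $ q"
    unfolding bump_def by (simp add: algebra_simps del: of_nat_Suc)
qed (intro continuous_intros)

text \<open>A Wirtinger derivative is a complex combination of two directional derivatives, each
  with integral zero.\<close>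

lemma has_bochner_integral_dbar:
  assumes "has_dbar F dF" and supp: "\<And>u. 1 \<le> norm u \<Longrightarrow> F u = 0"
  shows "has_bochner_integral lborel (\<lambda>u. dF u $ q) 0"
proof -
  obtain L where L: "\<And>u. (F has_derivative L u) (at u)" "\<And>v. continuous_on UNIV (\<lambda>u. L u v)"
    "\<And>u q. L u (axis q 1) + \<i> * L u (axis q \<i>) = 2 * dF u $ q"
    using assms(1) unfolding has_dbar_def by blast
  have L0: "has_bochner_integral lborel (\<lambda>u. L u v) 0" for v
    using L(1,2) supp by (rule integral_directional_derivative_eq_0)
  have "has_bochner_integral lborel (\<lambda>u. (1 / 2) * (L u (axis q 1) + \<i> * L u (axis q \<i>))) ((1 / 2) * (0 + \<i> * 0))"
    by (intro has_bochner_integral_mult_right has_bochner_integral_add L0)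
  then show ?thesis
    by (simp add: L(3))
qed

definition bump_integral :: "nat \<Rightarrow> (complex^'n \<Rightarrow> complex) \<Rightarrow> complex" where
  "bump_integral j F = (LINT u|lborel. F u * bump j u)"

lemma integrable_bump:
  assumes "continuous_on UNIV F" "0 < j"
  shows "integrable lborel (\<lambda>u. F u * bump j u)"
  using assms by (intro integrable_compact_support[of _ 1] continuous_intros continuous_bump)
    (auto simp: bump_def max_def power_le_one_iff abs_square_le_1)

text \<open>Integration by parts with \<open>\<partial>(bump (j + 1)) / \<partial>(cnj u\<^sub>q) = - (j + 1) u\<^sub>q bump j\<close>; here the bump
  functions play the role of the Gaussian density in Wick's formula.\<close>

lemma bump_integral_by_parts:
  assumes P: "has_dbar P dP" and j: "0 < j"
  shows "of_nat (Suc j) * bump_integral j (\<lambda>u. cinner (B *v u) u * P u) =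
    trace B * bump_integral (Suc j) P + bump_integral (Suc j) (\<lambda>u. cinner (B *v dP u) u)"
proof -
  note cont = has_dbar_imp_continuous[OF P]
  \<comment> \<open>This is the product rule for
    \<open>cinner (B *v axis q 1) u * P u * bump (Suc j) u\<close>; summing component
    \<open>q\<close> over all \<open>q\<close> forms a divergence.\<close>
  define dF where "dF q u = (cinner (B *v axis q 1) u * P u) *s ((- of_nat (Suc j) * bump j u) *s u)
      + bump (Suc j) u *s (cinner (B *v axis q 1) u *s dP u + P u *s (B *v axis q 1))" for q u
  have "has_bochner_integral lborel (\<lambda>u. dF q u $ q) 0" for q
  proof (rule has_bochner_integral_dbar)
    show "has_dbar (\<lambda>u. cinner (B *v axis q 1) u * P u * bump (Suc j) u) (dF q)"
      unfolding dF_def by (intro has_dbar_mult has_dbar_cinner P has_dbar_bump j)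
    show "cinner (B *v axis q 1) u * P u * bump (Suc j) u = 0" if "1 \<le> norm u" for u
      using that by (auto simp: bump_def max_def power_le_one_iff abs_square_le_1)
  qed
  then have "has_bochner_integral lborel (\<lambda>u. \<Sum>q\<in>UNIV. dF q u $ q) (\<Sum>q\<in>(UNIV::'a set). 0)"
    by (intro has_bochner_integral_sum) auto
  \<comment> \<open>Differentiating the antilinear factor gives the trace, differentiating
    \<open>P\<close> gives \<open>dP\<close>, and the factor \<open>u $ q\<close> from the bump
    reassembles the form of \<open>B\<close>.\<close>
  moreover have "(\<Sum>q\<in>UNIV. dF q u $ q) = trace B * (P u * bump (Suc j) u)
      + cinner (B *v dP u) u * bump (Suc j) u
      - of_nat (Suc j) * (cinner (B *v u) u * P u * bump j u)" for u
  proof -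
    have 1: "(\<Sum>q\<in>UNIV. cinner (B *v axis q 1) u * x $ q) = cinner (B *v x) u" for x
    proof -
      have "x = (\<Sum>q\<in>UNIV. x $ q *s axis q 1)"
        by (simp add: vec_eq_iff axis_def if_distrib cong: if_cong)
      then have "cinner (B *v x) u = cinner (B *v (\<Sum>q\<in>UNIV. x $ q *s axis q 1)) u"
        by simp
      also have "\<dots> = (\<Sum>q\<in>UNIV. cinner (B *v (x $ q *s axis q 1)) u)"
        by (simp add: linear_sum[OF bounded_linear.linear[OF bounded_linear_matrix_vector_mult]]
            bounded_bilinear.sum_left[OF bounded_bilinear_cinner])
      finally show ?thesis
        by (simp add: vector_scalar_commute cinner_scale_left mult.commute)
    qed
    have 2: "(\<Sum>q\<in>UNIV. (B *v axis q 1) $ q) = trace B"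
      by (simp add: trace_def matrix_vector_axis)
    have "dF q u $ q = - of_nat (Suc j) * P u * bump j u * (cinner (B *v axis q 1) u * u $ q)
        + bump (Suc j) u * (cinner (B *v axis q 1) u * dP u $ q)
        + P u * bump (Suc j) u * (B *v axis q 1) $ q" for q
      by (simp add: dF_def algebra_simps del: of_nat_Suc)
    then have "(\<Sum>q\<in>UNIV. dF q u $ q) =
          - of_nat (Suc j) * P u * bump j u * (\<Sum>q\<in>UNIV. cinner (B *v axis q 1) u * u $ q)
        + bump (Suc j) u * (\<Sum>q\<in>UNIV. cinner (B *v axis q 1) u * dP u $ q)
        + P u * bump (Suc j) u * (\<Sum>q\<in>UNIV. (B *v axis q 1) $ q)"
      by (simp only: sum.distrib sum_distrib_left)
    then show ?thesis
      unfolding 1 2 by (simp add: mult_ac del: of_nat_Suc)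
  qed
  ultimately have "has_bochner_integral lborel (\<lambda>u. trace B * (P u * bump (Suc j) u)
      + cinner (B *v dP u) u * bump (Suc j) u
      - of_nat (Suc j) * (cinner (B *v u) u * P u * bump j u)) 0"
    by simp
  moreover have "integrable lborel (\<lambda>u. P u * bump (Suc j) u)"
    "integrable lborel (\<lambda>u. cinner (B *v dP u) u * bump (Suc j) u)"
    "integrable lborel (\<lambda>u. cinner (B *v u) u * P u * bump j u)"
    using j by (intro integrable_bump continuous_intros cont; simp)+
  ultimately show ?thesis
    unfolding bump_integral_def by (simp add: has_bochner_integral_iff del: of_nat_Suc)
qed

section \<open>Moments of quadratic forms\<close>

definition form_prod :: "(complex^'n^'n) list \<Rightarrow> complex^'n \<Rightarrow> complex" where
  "form_prod As u = (\<Prod>A\<leftarrow>As. cinner (A *v u) u)"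

text \<open>The sum over all permutations of the product, over the cycles \<open>(i j k \<dots>)\<close>, of the traces
  of \<open>As ! i ** As ! j ** As ! k \<dots>\<close>, organised by the cycle of the first matrix.\<close>

function trace_perm_sum :: "(complex^'n^'n) list \<Rightarrow> complex" where
  "trace_perm_sum [] = 1"
| "trace_perm_sum (A # As) = trace A * trace_perm_sum As +
     (\<Sum>i<length As. trace_perm_sum (As[i := A ** As ! i]))"
  by pat_completeness auto
termination by (relation "Wellfounded.measure length") auto

lemma form_prod_Cons: "form_prod (A # As) = (\<lambda>u. cinner (A *v u) u * form_prod As u)"
  by (simp add: form_prod_def fun_eq_iff)

text \<open>By the product rule the derivative hits one factor at a time, and pairing it with
  \<open>u\<close> after applying \<open>B\<close> turns \<open>As ! i\<close> into
  \<open>B ** As ! i\<close>.\<close>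

lemma has_dbar_form_prod:
  "\<exists>dP. has_dbar (form_prod As) dP \<and>
     (\<forall>B u. cinner (B *v dP u) u = (\<Sum>i<length As. form_prod (As[i := B ** As ! i]) u))"
proof (induction As)
  case Nil
  have "has_dbar (form_prod []) (\<lambda>_. 0)"
    unfolding form_prod_def by (simp add: has_dbar_const)
  then show ?case by (auto intro!: exI[of _ "\<lambda>_. 0"])
next
  case (Cons A As)
  then obtain dP where dP: "has_dbar (form_prod As) dP"
    "\<And>B u. cinner (B *v dP u) u = (\<Sum>i<length As. form_prod (As[i := B ** As ! i]) u)"
    by blast
  have "has_dbar (form_prod (A # As))
      (\<lambda>u. cinner (A *v u) u *s dP u + form_prod As u *s (A *v u))"
    unfolding form_prod_Cons by (rule has_dbar_mult[OF has_dbar_quadratic_form dP(1)])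
  \<comment> \<open>Index 0 is the case where the derivative hits the head factor; the other indices
    are those of \<open>As\<close>, shifted by one.\<close>
  moreover have "cinner (B *v (cinner (A *v u) u *s dP u + form_prod As u *s (A *v u))) u =
      (\<Sum>i<length (A # As). form_prod ((A # As)[i := B ** (A # As) ! i]) u)" for B u
    unfolding matrix_vector_right_distrib vector_scalar_commute cinner_add_left cinner_scale_left dP(2)
    by (simp add: sum.lessThan_Suc_shift form_prod_def sum_distrib_left matrix_vector_mul_assoc mult_ac
        del: sum.lessThan_Suc)
  ultimately show ?case by blast
qed

lemma continuous_form_prod: "continuous_on UNIV (form_prod As)"
  using has_dbar_form_prod has_dbar_imp_continuous(1) by blast

text \<open>Each integration by parts consumes the first matrix, raises the bump index and
  contributes the next factor of the Pochhammer symbol, following the recursion of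
  \<open>trace_perm_sum\<close>. Induction is on the length because the updated lists are not
  sublists.\<close>

lemma bump_integral_form_prod:
  fixes As :: "(complex^'n^'n) list"
  shows "0 < j \<Longrightarrow> pochhammer (of_nat (Suc j)) (length As) * bump_integral j (form_prod As) =
     trace_perm_sum As * bump_integral (j + length As) (\<lambda>_ :: complex^'n. 1)"
proof (induction As arbitrary: j rule: length_induct)
  case (1 As)
  show ?case
  proof (cases As)
    case Nil
    then show ?thesis
      unfolding bump_integral_def form_prod_def by simp
  next
    case (Cons A Bs)
    let ?n = "length Bs"
    let ?I = "bump_integral (j + Suc ?n) (\<lambda>_ :: complex^'n. 1)"
    let ?p = "pochhammer (of_nat (Suc (Suc j))) ?n :: complex"
    obtain dP where dP: "has_dbar (form_prod Bs) dP"
      "\<And>B u. cinner (B *v dP u) u = (\<Sum>i<length Bs. form_prod (Bs[i := B ** Bs ! i]) u)"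
      using has_dbar_form_prod by blast
    have IH: "?p * bump_integral (Suc j) (form_prod Cs) = trace_perm_sum Cs * ?I"
      if "length Cs = ?n" for Cs :: "(complex^'n^'n) list"
      using 1(1)[rule_format, of Cs "Suc j"] that Cons by simp
    have "bump_integral (Suc j) (\<lambda>u. \<Sum>i<?n. form_prod (Bs[i := A ** Bs ! i]) u) =
        (\<Sum>i<?n. bump_integral (Suc j) (form_prod (Bs[i := A ** Bs ! i])))"
      unfolding bump_integral_def sum_distrib_right
      by (intro Bochner_Integration.integral_sum integrable_bump continuous_form_prod) simp
    then have "of_nat (Suc j) * bump_integral j (form_prod As) =
        trace A * bump_integral (Suc j) (form_prod Bs) +
        (\<Sum>i<?n. bump_integral (Suc j) (form_prod (Bs[i := A ** Bs ! i])))"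
      using bump_integral_by_parts[OF dP(1) 1(2), of A] Cons by (simp add: dP(2) form_prod_Cons)
    then have "?p * (of_nat (Suc j) * bump_integral j (form_prod As)) =
        trace A * (?p * bump_integral (Suc j) (form_prod Bs)) +
        (\<Sum>i<?n. ?p * bump_integral (Suc j) (form_prod (Bs[i := A ** Bs ! i])))"
      by (simp only: distrib_left sum_distrib_left mult.left_commute)
    also have "\<dots> = trace_perm_sum As * ?I"
      by (simp only: IH[OF refl] IH[OF length_list_update])
        (simp add: Cons distrib_right sum_distrib_right)
    finally show ?thesis
      by (simp add: Cons pochhammer_rec mult_ac add_ac)
  qed
qed

text \<open>The weight is positive on the open ball, which has positive volume. This permits
  cancelling the common factor of two moments.\<close>

lemma bump_integral_1_nonzero: "bump_integral j (\<lambda>_ :: complex^'n. 1) \<noteq> 0" if "0 < j"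
proof -
  let ?f = "\<lambda>u::complex^'n. max 0 (1 - (norm u)\<^sup>2) ^ j"
  have f: "bump j = (\<lambda>u::complex^'n. complex_of_real (?f u))"
    by (simp add: bump_def fun_eq_iff)
  have int: "integrable lborel ?f"
    using that by (intro integrable_compact_support[of _ 1] continuous_intros)
      (auto simp: max_def power_le_one_iff abs_square_le_1)
  have "(LINT u|lborel. ?f u) \<noteq> 0"
  proof
    assume "(LINT u|lborel. ?f u) = 0"
    then have "AE u in lborel. ?f u = 0"
      by (intro integral_nonneg_eq_0_iff_AE[OF int, THEN iffD1]) auto
    moreover have "(norm u)\<^sup>2 < 1" if "norm u < 1" for u :: "complex^'n"
      using that by (simp add: abs_square_less_1)
    ultimately have "AE u in lborel. u \<notin> ball (0::complex^'n) 1"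
      by (elim eventually_mono) (force simp: max_def split: if_splits)
    then have "emeasure lborel (ball (0::complex^'n) 1) = 0"
      by (subst (asm) AE_iff_measurable[where N="ball 0 1"]) auto
    then show False
      using unit_ball_vol_pos[of "real DIM(complex^'n)"] by (simp add: emeasure_ball del: unit_ball_vol_pos)
  qed
  then show ?thesis
    unfolding bump_integral_def f by (simp del: of_real_power)
qed

text \<open>The moment formula is used for the given matrices and for four identity matrices; the
  factors common to both, the Pochhammer symbol and \<open>?J\<close>, cancel.\<close>

lemma sphere_average_form_prod:
  fixes A :: "complex^'n^'n"
  shows "complex_of_real (c_const CARD('n) * (LINT u|sphere_sigma. cmod (cinner (A *v u) u) ^ 4)) =
    trace_perm_sum [A, A, ctranspose A, ctranspose A]"
proof -
  define f where "f u = cmod (cinner (A *v u) u) ^ 4" for u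
  \<comment> \<open>This profile is that of \<open>bump 1\<close>, the lowest index the moment
    formula admits; four integrations by parts lead to the index 5 in \<open>?J\<close>.\<close>
  define \<psi> where "\<psi> r = max 0 (1 - r\<^sup>2)" for r :: real
  let ?I = "[mat 1, mat 1, mat 1, mat 1] :: (complex^'n^'n) list"
  let ?J = "bump_integral 5 (\<lambda>_::complex^'n. 1)"
  have "f (c *\<^sub>R u) = c ^ 8 * f u" if "0 < c" for c u
  proof -
    have "c *\<^sub>R u = complex_of_real c *s u"
      by (simp add: vec_eq_iff) (simp add: scaleR_conv_of_real)
    then have "cinner (A *v (c *\<^sub>R u)) (c *\<^sub>R u) = complex_of_real (c\<^sup>2) * cinner (A *v u) u"
      by (simp add: vector_scalar_commute cinner_scale_left cinner_scale_right power2_eq_square)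
    then show ?thesis
      by (simp add: f_def norm_mult power_mult_distrib norm_power flip: power_mult)
  qed
  moreover have "continuous_on UNIV \<psi>"
    unfolding \<psi>_def by (intro continuous_intros)
  ultimately have *: "(LINT u|sphere_sigma. f u) * (LINT u|lborel. norm (u::complex^'n) ^ 8 * \<psi> (norm u)) =
      (LINT u|lborel. f u * \<psi> (norm u))"
    by (intro integral_sphere_sigma_homogeneous)
      (auto simp: f_def \<psi>_def intro!: continuous_intros)
  have A: "complex_of_real (LINT u|lborel. f u * \<psi> (norm u)) =
      bump_integral 1 (form_prod [A, A, ctranspose A, ctranspose A])"
  proof -
    have "cinner (ctranspose A *v u) u = cnj (cinner (A *v u) u)" for u
      by (simp add: cinner_matrix_left cnj_cinner)
    then have "complex_of_real (f u) = form_prod [A, A, ctranspose A, ctranspose A] u" for u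
      using complex_norm_square[of "cinner (A *v u) u"]
      by (simp add: form_prod_def f_def power4_eq_xxxx power2_eq_square mult_ac)
    then have "form_prod [A, A, ctranspose A, ctranspose A] u * bump 1 u = complex_of_real (f u * \<psi> (norm u))" for u
      by (simp add: bump_def \<psi>_def)
    then show ?thesis
      unfolding bump_integral_def by (simp del: of_real_mult)
  qed
  have I: "complex_of_real (LINT u|lborel. norm (u::complex^'n) ^ 8 * \<psi> (norm u)) =
      bump_integral 1 (form_prod ?I)"
  proof -
    have "form_prod ?I u * bump 1 u = complex_of_real (norm u ^ 8 * \<psi> (norm u))" for u
      by (simp add: form_prod_def bump_def \<psi>_def cinner_self eval_nat_numeral)
    then show ?thesis
      unfolding bump_integral_def by (simp del: of_real_mult)
  qed
  \<comment> \<open>Summing \<open>n ^ k\<close> over the permutations of four points,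
    \<open>k\<close> being the number of cycles, gives the rising factorial
    \<open>n * (n + 1) * (n + 2) * (n + 3)\<close>.\<close>
  have tI: "trace_perm_sum ?I = complex_of_real (c_const CARD('n))"
    by (simp add: trace_I lessThan_Suc c_const_def numeral_eq_Suc algebra_simps)
  have moment: "pochhammer 2 4 * bump_integral 1 (form_prod As) = trace_perm_sum As * ?J"
    if "length As = 4" for As :: "(complex^'n^'n) list"
    using bump_integral_form_prod[of 1 As] that by simp
  have "trace_perm_sum [A, A, ctranspose A, ctranspose A] * ?J =
      pochhammer 2 4 * complex_of_real (LINT u|lborel. f u * \<psi> (norm u))"
    unfolding A by (rule moment[symmetric]) simp
  \<comment> \<open>The spherical mean splits off and leaves the moment of the identity
    matrices.\<close>
  also have "\<dots> = complex_of_real (LINT u|sphere_sigma. f u) * (pochhammer 2 4 * bump_integral 1 (form_prod ?I))"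
    by (simp add: I flip: *)
  also have "pochhammer 2 4 * bump_integral 1 (form_prod ?I) = complex_of_real (c_const CARD('n)) * ?J"
    by (subst moment) (simp_all only: tI, simp)
  finally show ?thesis
    using bump_integral_1_nonzero[of 5, where 'n='n] by (simp add: f_def mult_ac del: trace_perm_sum.simps)
qed

text \<open>In the notation of the proof the 24 permutations contribute as follows: 4-cycles
  \<open>4 * a + 2 * b\<close>, 3-cycles \<open>8 * Re (t * q)\<close>, double transpositions
  \<open>2 * p\<^sup>2\<close> and \<open>|s|^2\<close>, transpositions \<open>4 * p * |t|^2\<close>
  and \<open>2 * Re (s * (cnj t)\<^sup>2)\<close>, the identity \<open>|t|^4\<close>.\<close>

lemma trace_perm_sum_ctranspose:
  "trace_perm_sum [A, A, ctranspose A, ctranspose A] =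
           4 * trace (mat_pow A 2 ** mat_pow (ctranspose A) 2)
         + 2 * trace (mat_pow (ctranspose A ** A) 2)
         + 2 * (trace (ctranspose A ** A))\<^sup>2
         + complex_of_real (8 * Re (trace A * trace (A ** mat_pow (ctranspose A) 2)))
         + complex_of_real (2 * Re (trace (mat_pow A 2) * (trace (ctranspose A))\<^sup>2))
         + complex_of_real ((cmod (trace (mat_pow A 2)))\<^sup>2)
         + 4 * trace (ctranspose A ** A) * complex_of_real ((cmod (trace A))\<^sup>2)
         + complex_of_real ((cmod (trace A)) ^ 4)"
proof -
  let ?B = "ctranspose A"
  define t s p q r a b where "t = trace A" and "s = trace (A ** A)" and "p = trace (A ** ?B)"
    and "q = trace (A ** ?B ** ?B)" and "r = trace (A ** A ** ?B)" 
    and "a = trace (A ** A ** ?B ** ?B)" and "b = trace (A ** ?B ** A ** ?B)"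
  have conj: "trace ?B = cnj t" "trace (?B ** ?B) = cnj s" "r = cnj q"
  proof -
    show "trace ?B = cnj t" "trace (?B ** ?B) = cnj s"
      by (simp_all add: t_def s_def trace_ctranspose flip: ctranspose_matrix_mult)
    have "ctranspose (A ** ?B ** ?B) = A ** A ** ?B"
      by (simp add: ctranspose_matrix_mult matrix_mul_assoc)
    then show "r = cnj q"
      unfolding r_def q_def by (metis trace_ctranspose)
  qed
  \<comment> \<open>Cyclic invariance reduces every word in \<open>A\<close> and \<open>?B\<close>
    that occurs to one of the named traces.\<close>
  have cyc: "trace (?B ** A) = p" "trace (A ** ?B ** A) = r" "trace (A ** ?B ** A ** ?B) = b"
    "trace (?B ** A ** ?B ** A) = b" "trace (A ** ?B ** ?B ** A) = a" "trace (?B ** A ** ?B) = q"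
    "trace (?B ** A ** A ** ?B) = a"
    unfolding p_def q_def r_def b_def a_def
    using trace_mul_sym[of ?B A] trace_mul_sym[of "A ** ?B" A] trace_mul_sym[of "?B" "A ** ?B ** A"]
      trace_mul_sym[of "A ** ?B ** ?B" A] trace_mul_sym[of ?B "A ** ?B"]
      trace_mul_sym[of ?B "A ** A ** ?B"]
    by (simp_all add: matrix_mul_assoc)
  \<comment> \<open>The 3-cycles and the transpositions of equal matrices come in conjugate
    pairs.\<close>
  have re: "complex_of_real (2 * Re z) = z + cnj z" for z
    by (simp add: complex_add_cnj)
  have "complex_of_real (8 * Re (t * q)) = 4 * (t * q + cnj t * r)"
  proof -
    have "complex_of_real (8 * Re (t * q)) = 4 * complex_of_real (2 * Re (t * q))"
      by simp
    then show ?thesis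
      unfolding re by (simp add: conj)
  qed
  moreover have "complex_of_real (2 * Re (s * (cnj t)\<^sup>2)) = s * (cnj t)\<^sup>2 + cnj s * t\<^sup>2"
    by (subst re) simp
  moreover have "complex_of_real (cmod t ^ 4) = (t * cnj t)\<^sup>2"
    unfolding complex_norm_square[symmetric] by simp
  ultimately show ?thesis
    unfolding mat_pow_2 matrix_mul_assoc cyc conj complex_norm_square
      t_def[symmetric] s_def[symmetric] p_def[symmetric] q_def[symmetric] a_def[symmetric]
    by (simp add: lessThan_Suc numeral_eq_Suc matrix_mul_assoc cyc conj
        t_def[symmetric] s_def[symmetric] p_def[symmetric] q_def[symmetric] a_def[symmetric]
        r_def[symmetric] b_def[symmetric])
      (simp add: algebra_simps)
qed

theorem corollary4p2:
  fixes A :: "complex ^ 'n ^ 'n"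
  shows "(complex_of_real
           (c_const CARD('n) * (LINT u|sphere_sigma. (cmod (cinner (A *v u) u)) ^ 4)) =
           4 * trace (mat_pow A 2 ** mat_pow (ctranspose A) 2)
         + 2 * trace (mat_pow (ctranspose A ** A) 2)
         + 2 * (trace (ctranspose A ** A))\<^sup>2
         + complex_of_real (8 * Re (trace A * trace (A ** mat_pow (ctranspose A) 2)))
         + complex_of_real (2 * Re (trace (mat_pow A 2) * (trace (ctranspose A))\<^sup>2))
         + complex_of_real ((cmod (trace (mat_pow A 2)))\<^sup>2)
         + 4 * trace (ctranspose A ** A) * complex_of_real ((cmod (trace A))\<^sup>2)
         + complex_of_real ((cmod (trace A)) ^ 4))
    \<and> Phi4 A = root 4 (1 / c_const CARD('n) *
          (4 * (frobenius_norm (mat_pow A 2))\<^sup>2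
         + 2 * (schatten4_norm A) ^ 4
         + 2 * (frobenius_norm A) ^ 4
         + 8 * Re (trace A * trace (A ** mat_pow (ctranspose A) 2))
         + 2 * Re (trace (mat_pow A 2) * (trace (ctranspose A))\<^sup>2)
         + 4 * (frobenius_norm A)\<^sup>2 * (cmod (trace A))\<^sup>2
         + (cmod (trace (mat_pow A 2)))\<^sup>2
         + (cmod (trace A)) ^ 4))"
  (is "?moment \<and> Phi4 A = root 4 (1 / ?c * ?S)")
proof
  show mom: ?moment
    using sphere_average_form_prod[of A] trace_perm_sum_ctranspose[of A] by (rule trans)
  let ?E = "LINT u|sphere_sigma. (cmod (cinner (A *v u) u)) ^ 4"
  have "trace (mat_pow A 2 ** mat_pow (ctranspose A) 2) = complex_of_real ((frobenius_norm (mat_pow A 2))\<^sup>2)"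
    unfolding ctranspose_mat_pow_2[symmetric] by (rule trace_mult_ctranspose)
  \<comment> \<open>Every trace outside a real part or modulus is now a power of a norm, so the
    complex identity descends to the reals.\<close>
  then have "complex_of_real (?c * ?E) = complex_of_real ?S"
    unfolding mom trace_ctranspose_mult schatten4_norm_power4[symmetric]
    by (simp add: algebra_simps flip: power_mult)
  then have "?c * ?E = ?S"
    unfolding of_real_eq_iff .
  moreover have "?c \<noteq> 0"
    unfolding c_const_def of_nat_eq_0_iff by simp
  ultimately have "?E = 1 / ?c * ?S"
    by (simp add: field_simps)
  then show "Phi4 A = root 4 (1 / ?c * ?S)"
    by (simp add: Phi4_def)
qed

end
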